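(* Let $a<b$ and $c<d$ be real numbers, let $\Delta=[a,b]\times[c,d]\subset\mathbb{R}^2$, and suppose that $f:\Delta\to\mathbb{R}$ is convex on the co-ordinates on $\Delta$. Define $G:[0,1]^2\to\mathbb{R}$ by $$\begin{aligned}G(t,s)=\frac14\Big[&f\left(ta+(1-t)\tfrac{a+b}{2},\,sc+(1-s)\tfrac{c+d}{2}\right)+f\left(tb+(1-t)\tfrac{a+b}{2},\,sc+(1-s)\tfrac{c+d}{2}\right)\\&+f\left(ta+(1-t)\tfrac{a+b}{2},\,sd+(1-s)\tfrac{c+d}{2}\right)+f\left(tb+(1-t)\tfrac{a+b}{2},\,sd+(1-s)\tfrac{c+d}{2}\right)\Big].\end{aligned}$$ Then: (i) $G$ is convex on the co-ordinates on $[0,1]^2$. (ii) We have the bounds $$\inf_{(t,s)\in[0,1]^2}G(t,s)=f\left(\frac{a+b}{2},\frac{c+d}{2}\right)=G(0,0),$$ $$\sup_{(t,s)\in[0,1]^2}G(t,s)=\frac{f(a,c)+f(a,d)+f(b,c)+f(b,d)}{4}=G(1,1).$$ (iii) If $f$ satisfies Lipschitzian conditions (that is, $f$ is $L$-Lipschitzian on $\Delta$ for some $L=(L_1,L_2)$ with $L_1,L_2\ge 0$), then $G$ is $L'$-Lipschitzian on $[0,1]\times[0,1]$ for some $L'=(L_1',L_2')$ with $L_1',L_2'\ge 0$. (iv) The following inequality holds: $$\begin{aligned}\frac{1}{(b-a)(d-c)}\int_a^b\int_c^d f(x,y)\,dy\,dx\le\frac14\Big[&\frac{f(a,c)+f(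b,c)+f(a,d)+f(b,d)}{4}\\&+\frac{f\left(\frac{a+b}{2},c\right)+f\left(\frac{a+b}{2},d\right)}{2}+f\left(\frac{a+b}{2},\frac{c+d}{2}\right)\Big].\end{aligned}$$
   Context: A function $g:[\alpha,\beta]\times[\gamma,\delta]\to\mathbb{R}$ (with $\alpha<\beta$, $\gamma<\delta$) is called convex on the co-ordinates if for every $y\in[\gamma,\delta]$ the partial mapping $u\mapsto g(u,y)$ is convex on $[\alpha,\beta]$, and for every $x\in[\alpha,\beta]$ the partial mapping $v\mapsto g(x,v)$ is convex on $[\gamma,\delta]$. For $V\subset\mathbb{R}^n$ and $L=(L_1,\dots,L_n)$ with all $L_i\ge 0$, a function $g:V\to\mathbb{R}$ is called $L$-Lipschitzian if $|g(x)-g(y)|\le\sum_{i=1}^n L_i|x_i-y_i|$ for all $x,y\in V$.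
   Formalization: In (iv) the bracket on the right-hand side carries the additional term (f(a,(c+d)/2)+f(b,(c+d)/2))/2; without it the inequality is false, e.g. for f=1 it would read 1 ≤ 3/4. *)

theory Defs
  imports "HOL-Analysis.Analysis"
begin

definition convex_on_coords :: "real set \<Rightarrow> real set \<Rightarrow> (real \<times> real \<Rightarrow> real) \<Rightarrow> bool" where
  "convex_on_coords A B g \<longleftrightarrow>
     (\<forall>y\<in>B. convex_on A (\<lambda>u. g (u, y))) \<and> (\<forall>x\<in>A. convex_on B (\<lambda>v. g (x, v)))"

(* The vector L is the tuple of constants: its coordinates along the standard basis are the L_i.
   For functions on real \<times> real it is the pair (L_1, L_2). *)
definition lipschitzian_on :: "'a::euclidean_space \<Rightarrow> 'a set \<Rightarrow> ('a \<Rightarrow> real) \<Rightarrow> bool" where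
  "lipschitzian_on L V g \<longleftrightarrow>
     (\<forall>i\<in>Basis. 0 \<le> L \<bullet> i) \<and>
     (\<forall>x\<in>V. \<forall>y\<in>V. \<bar>g x - g y\<bar> \<le> (\<Sum>i\<in>Basis. (L \<bullet> i) * \<bar>x \<bullet> i - y \<bullet> i\<bar>))"

(* The theorem about these notions includes a Bullen-type bound on the integral mean, stated with
   all four terms that come from applying Bullen's inequality in each variable. The source omits
   the term (f (a, (c+d)/2) + f (b, (c+d)/2)) / 2; without it the bound is false, since for the
   constant function 1 its right-hand side is 3/4. *)

end

theory Submission
  imports Defs
begin

text \<open>
  Everything reduces to one variable. For a convex h on [a, b] with midpoint m, average h over the
  two points reached from m after the fraction t of the way to either endpoint. The
  resulting symmetrization of h is convex in t, being an average of affine reparametrizations of h;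
  it equals h(m) at t = 0 and the mean of the endpoint values at t = 1; and it is nowhere below
  its value at 0, because h(m) is at most the mean of h over two points symmetric about m. By
  convexity it is therefore nowhere above its value at 1.

  The function G is the symmetrization of f in one variable followed by that in the other, in
  either order. Hence G inherits convexity on the co-ordinates, and the two-dimensional bounds
  come from using the one-dimensional ones twice. The affine reparametrization scales lengths by
  half the side of the rectangle, so the Lipschitz constants of f are scaled in the same way.

  For the integral bound, the chord above a convex function gives the trapezoid estimate, and this
  estimate on both halves of the interval gives Bullen's inequality
  \<open>bullen_inequality\<close>. The inner integral of f is a convex function of the outer
  variable, so Bullen's inequality applies to it; it then applies once more to the three sections
  of f that appear on the right-hand side. All the integrals exist because a convex function on a
  compact interval is bounded, and continuous off the endpoints
  (\<open>convex_on_imp_integrable\<close>).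
\<close>

section \<open>Symmetrization of a convex function about the midpoint\<close>

definition symmetrization :: "real \<Rightarrow> real \<Rightarrow> (real \<Rightarrow> real) \<Rightarrow> real \<Rightarrow> real" where
  "symmetrization a b h t =
     (h (t * a + (1 - t) * ((a + b) / 2)) + h (t * b + (1 - t) * ((a + b) / 2))) / 2"

lemma symmetrization_0: "symmetrization a b h 0 = h ((a + b) / 2)"
  by (simp add: symmetrization_def)

lemma symmetrization_1: "symmetrization a b h 1 = (h a + h b) / 2"
  by (simp add: symmetrization_def)

lemma convex_on_cong_fun:
  assumes "convex_on S g" "\<And>x. x \<in> S \<Longrightarrow> f x = g x"
  shows "convex_on S f"
proof -
  have "convex S"
    using assms(1) by (rule convex_on_imp_convex)
  then show ?thesis
    using assms by (auto simp: convex_on_def convex_def)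
qed

lemma convex_on_along_segment:
  fixes h :: "real \<Rightarrow> real"
  assumes h: "convex_on S h" and "p \<in> S" "q \<in> S"
  shows "convex_on {0..1} (\<lambda>t. h (t * p + (1 - t) * q))"
proof (rule convex_onI)
  have mem: "t * p + (1 - t) * q \<in> S" if "t \<in> {0..1}" for t
    using convexD[OF convex_on_imp_convex[OF h] assms(2,3), of t "1 - t"] that by simp
  fix u x y :: real
  assume u: "0 < u" "u < 1" and xy: "x \<in> {0..1}" "y \<in> {0..1}"
  have "((1 - u) * x + u * y) * p + (1 - ((1 - u) * x + u * y)) * q
      = (1 - u) * (x * p + (1 - x) * q) + u * (y * p + (1 - y) * q)"
    by (simp add: algebra_simps)
  then show "h (((1 - u) *\<^sub>R x + u *\<^sub>R y) * p + (1 - ((1 - u) *\<^sub>R x + u *\<^sub>R y)) * q)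
      \<le> (1 - u) * h (x * p + (1 - x) * q) + u * h (y * p + (1 - y) * q)"
    using convex_onD[OF h, of u "x * p + (1 - x) * q" "y * p + (1 - y) * q"] u mem xy by simp
qed simp

lemma convex_on_average:
  fixes g h :: "'a::real_vector \<Rightarrow> real"
  assumes "convex_on S g" "convex_on S h"
  shows "convex_on S (\<lambda>x. (g x + h x) / 2)"
  using assms by (intro convex_on_cdiv convex_on_add) auto

lemma convex_on_symmetrization:
  assumes "a \<le> b" "convex_on {a..b} h"
  shows "convex_on {0..1} (symmetrization a b h)"
proof -
  have "convex_on {0..1} (\<lambda>t. symmetrization a b h t)"
    unfolding symmetrization_def
    using assms by (intro convex_on_average convex_on_along_segment[where S = "{a..b}"]) auto
  then show ?thesis .
qed

lemma convex_on_midpoint_le: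
  fixes h :: "real \<Rightarrow> real"
  assumes "convex_on S h" "x \<in> S" "y \<in> S"
  shows "h ((x + y) / 2) \<le> (h x + h y) / 2"
  using convex_onD[OF assms(1), of "1/2" x y] assms(2,3) by (simp add: field_simps)

lemma segment_to_midpoint_mem:
  fixes a b :: real
  assumes "a \<le> b" "t \<in> {0..1}"
  shows "t * a + (1 - t) * ((a + b) / 2) \<in> {a..b}" "t * b + (1 - t) * ((a + b) / 2) \<in> {a..b}"
  using assms convexD[of "{a..b}" a "(a + b) / 2" t "1 - t"]
    convexD[of "{a..b}" b "(a + b) / 2" t "1 - t"] by auto

lemma symmetrization_ge_midpoint:
  assumes "a \<le> b" "convex_on {a..b} h" "t \<in> {0..1}"
  shows "h ((a + b) / 2) \<le> symmetrization a b h t"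
proof -
  have "(t * a + (1 - t) * ((a + b) / 2) + (t * b + (1 - t) * ((a + b) / 2))) / 2 = (a + b) / 2"
    by (simp add: field_simps)
  then show ?thesis
    using convex_on_midpoint_le[OF assms(2) segment_to_midpoint_mem[OF assms(1,3)]]
    by (simp only: symmetrization_def)
qed

text \<open>
  A convex function on [0, 1] that is minimal at 0 is maximal at 1: on the chord from 0 to 1 the
  value at 1 is the larger of the two.
\<close>

lemma symmetrization_le_endpoints:
  assumes "a \<le> b" "convex_on {a..b} h" "t \<in> {0..1}"
  shows "symmetrization a b h t \<le> (h a + h b) / 2"
proof -
  have "symmetrization a b h t \<le> max (symmetrization a b h 0) (symmetrization a b h 1)"
    by (rule convex_on_le_max[OF convex_on_symmetrization[OF assms(1,2)] assms(3)])
  also have "\<dots> = symmetrization a b h 1"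
    using symmetrization_ge_midpoint[OF assms(1,2), of 1] by (simp add: symmetrization_0)
  finally show ?thesis
    by (simp add: symmetrization_1)
qed

section \<open>Integrals of convex functions\<close>

text \<open>
  The maximum of the endpoint values bounds a convex function above, and reflecting in the midpoint
  turns this into a bound below. Only the interior is used for measurability, since a convex
  function may jump at the endpoints.
\<close>

lemma convex_on_imp_integrable:
  fixes h :: "real \<Rightarrow> real"
  assumes h: "convex_on {a..b} h"
  shows "h integrable_on {a..b}"
proof -
  define M where "M = max (h a) (h b)"
  define m where "m = h ((a + b) / 2)"
  define K where "K = \<bar>M\<bar> + 2 * \<bar>m\<bar>"
  have bound: "\<bar>h x\<bar> \<le> K" if "x \<in> {a<..<b}" for x
  proof -
    have "h x \<le> M" "h (a + b - x) \<le> M"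
      unfolding M_def using that by (auto intro!: convex_on_le_max[OF h])
    moreover have "2 * m \<le> h x + h (a + b - x)"
      using convex_on_midpoint_le[OF h, of x "a + b - x"] that by (simp add: m_def)
    ultimately show ?thesis
      unfolding K_def by linarith
  qed
  have "continuous_on {a<..<b} h"
    by (intro convex_on_continuous convex_on_subset[OF h]) auto
  then have "h \<in> borel_measurable (lebesgue_on {a<..<b})"
    by (intro continuous_imp_measurable_on_sets_lebesgue) auto
  moreover have "(\<lambda>x. K) integrable_on {a<..<b}"
    by (simp add: integrable_on_open_interval_real integrable_const_ivl)
  ultimately have "h integrable_on {a<..<b}"
    using bound by (rule measurable_bounded_by_integrable_imp_integrable_real) simp_all
  then show ?thesis
    by (simp add: integrable_on_open_interval_real)
qed

text \<open>The graph of a convex function lies below its chord.\<close>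

lemma convex_integral_le_trapezoid:
  fixes h :: "real \<Rightarrow> real"
  assumes ab: "a \<le> b" and h: "convex_on {a..b} h"
  shows "integral {a..b} h \<le> (b - a) * ((h a + h b) / 2)"
proof (cases "a = b")
  case False
  define k where "k = (h b - h a) / (b - a)"
  have k: "k * (b - a) = h b - h a"
    using False by (simp add: k_def)
  have chord: "((\<lambda>x. k * (x - a) + h a) has_integral
      (k * (b - a)\<^sup>2 / 2 + h a * b) - (k * (a - a)\<^sup>2 / 2 + h a * a)) {a..b}"
    by (intro fundamental_theorem_of_calculus ab)
      (auto intro!: derivative_eq_intros simp flip: has_real_derivative_iff_has_vector_derivative)
  have "integral {a..b} h \<le> integral {a..b} (\<lambda>x. k * (x - a) + h a)"
    using convex_onD_Icc'[OF h] unfolding k_def[symmetric]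
    by (intro integral_le convex_on_imp_integrable[OF h] has_integral_integrable[OF chord]) auto
  also have "\<dots> = k * (b - a) * (b - a) / 2 + h a * (b - a)"
    using integral_unique[OF chord] by (simp add: power2_eq_square algebra_simps)
  also have "\<dots> = (b - a) * ((h a + h b) / 2)"
    unfolding k by (simp add: field_simps)
  finally show ?thesis .
qed simp

lemma bullen_inequality:
  fixes h :: "real \<Rightarrow> real"
  assumes ab: "a \<le> b" and h: "convex_on {a..b} h"
  shows "integral {a..b} h \<le> (b - a) / 2 * ((h a + h b) / 2 + h ((a + b) / 2))"
proof -
  define m where "m = (a + b) / 2"
  have m: "a \<le> m" "m \<le> b" "m - a = (b - a) / 2" "b - m = (b - a) / 2"
    using ab by (auto simp: m_def field_simps)
  have "integral {a..b} h = integral {a..m} h + integral {m..b} h"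
    using Henstock_Kurzweil_Integration.integral_combine[OF m(1,2) convex_on_imp_integrable[OF h]] by simp
  also have "\<dots> \<le> (m - a) * ((h a + h m) / 2) + (b - m) * ((h m + h b) / 2)"
    using m by (intro add_mono convex_integral_le_trapezoid convex_on_subset[OF h]) auto
  also have "\<dots> = (b - a) / 2 * ((h a + h b) / 2 + h m)"
    unfolding m(3,4) by (simp add: field_simps)
  finally show ?thesis
    by (simp add: m_def)
qed

text \<open>
  Integrating out one variable preserves convexity in the other: the convexity inequality holds at
  each value of the integrated variable, and the integral is monotone and linear.
\<close>

lemma convex_on_integral_section:
  fixes f :: "real \<times> real \<Rightarrow> real"
  assumes f: "convex_on_coords {a..b} {c..d} f"
  shows "convex_on {a..b} (\<lambda>x. integral {c..d} (\<lambda>y. f (x, y)))"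
proof (rule convex_onI)
  have int: "(\<lambda>y. f (x, y)) integrable_on {c..d}" if "x \<in> {a..b}" for x
    using f that by (intro convex_on_imp_integrable) (auto simp: convex_on_coords_def)
  fix t x y :: real
  assume t: "0 < t" "t < 1" and xy: "x \<in> {a..b}" "y \<in> {a..b}"
  have z: "(1 - t) *\<^sub>R x + t *\<^sub>R y \<in> {a..b}"
    using convexD[of "{a..b}" x y "1 - t" t] t xy by simp
  have "integral {c..d} (\<lambda>v. f ((1 - t) *\<^sub>R x + t *\<^sub>R y, v))
      \<le> integral {c..d} (\<lambda>v. (1 - t) * f (x, v) + t * f (y, v))"
  proof (rule integral_le[OF int[OF z]])
    show "(\<lambda>v. (1 - t) * f (x, v) + t * f (y, v)) integrable_on {c..d}"
      using int xy by (intro integrable_add integrable_on_mult_right) auto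
    fix v assume "v \<in> {c..d}"
    then have "convex_on {a..b} (\<lambda>u. f (u, v))"
      using f by (simp add: convex_on_coords_def)
    from convex_onD[OF this, of t x y]
    show "f ((1 - t) *\<^sub>R x + t *\<^sub>R y, v) \<le> (1 - t) * f (x, v) + t * f (y, v)"
      using t xy by simp
  qed
  also have "\<dots> = (1 - t) * integral {c..d} (\<lambda>v. f (x, v)) + t * integral {c..d} (\<lambda>v. f (y, v))"
    using int xy by (subst Henstock_Kurzweil_Integration.integral_add)
      (auto intro!: integrable_on_mult_right)
  finally show "integral {c..d} (\<lambda>v. f ((1 - t) *\<^sub>R x + t *\<^sub>R y, v))
      \<le> (1 - t) * integral {c..d} (\<lambda>v. f (x, v)) + t * integral {c..d} (\<lambda>v. f (y, v))" .
qed simp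

text \<open>
  Bullen's inequality for the inner integral, as a function of x, leaves its values at the endpoints
  and the midpoint; each of these is the integral of one section, to which the inequality applies
  again.
\<close>

lemma bullen_inequality_coords:
  fixes f :: "real \<times> real \<Rightarrow> real"
  assumes ab: "a \<le> b" and cd: "c \<le> d" and f: "convex_on_coords {a..b} {c..d} f"
  shows "integral {a..b} (\<lambda>x. integral {c..d} (\<lambda>y. f (x, y)))
    \<le> (b - a) * (d - c) *
      (1/4 * ((f (a, c) + f (b, c) + f (a, d) + f (b, d)) / 4
            + (f ((a + b) / 2, c) + f ((a + b) / 2, d)) / 2
            + (f (a, (c + d) / 2) + f (b, (c + d) / 2)) / 2
            + f ((a + b) / 2, (c + d) / 2)))"
proof -
  define F where "F x = integral {c..d} (\<lambda>y. f (x, y))" for x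
  define B where "B x = (f (x, c) + f (x, d)) / 2 + f (x, (c + d) / 2)" for x
  have F: "F x \<le> (d - c) / 2 * B x" if "x \<in> {a..b}" for x
    using bullen_inequality[OF cd, of "\<lambda>y. f (x, y)"] f that
    by (simp add: F_def B_def convex_on_coords_def)
  have "convex_on {a..b} F"
    using convex_on_integral_section[OF f] by (simp add: F_def[abs_def])
  then have "integral {a..b} F \<le> (b - a) / 2 * ((F a + F b) / 2 + F ((a + b) / 2))"
    by (rule bullen_inequality[OF ab])
  also have "\<dots> \<le> (b - a) / 2 *
      (((d - c) / 2 * B a + (d - c) / 2 * B b) / 2 + (d - c) / 2 * B ((a + b) / 2))"
    using ab by (intro mult_left_mono add_mono divide_right_mono F) auto
  also have "\<dots> = (b - a) * (d - c) * (1/4 * ((B a + B b) / 2 + B ((a + b) / 2)))"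
    by (simp add: field_simps)
  also have "(B a + B b) / 2 + B ((a + b) / 2)
      = (f (a, c) + f (b, c) + f (a, d) + f (b, d)) / 4
        + (f ((a + b) / 2, c) + f ((a + b) / 2, d)) / 2
        + (f (a, (c + d) / 2) + f (b, (c + d) / 2)) / 2 + f ((a + b) / 2, (c + d) / 2)"
    by (simp add: B_def field_simps)
  finally show ?thesis
    by (simp add: F_def[abs_def])
qed

section \<open>Symmetrization in both variables\<close>

definition symmetrization2 ::
  "real \<Rightarrow> real \<Rightarrow> real \<Rightarrow> real \<Rightarrow> (real \<times> real \<Rightarrow> real) \<Rightarrow> real \<Rightarrow> real \<Rightarrow> real" where
  "symmetrization2 a b c d f t s =
     symmetrization a b (\<lambda>u. symmetrization c d (\<lambda>v. f (u, v)) s) t"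

text \<open>
  Each variable can be made the outer one, where the results about \<open>symmetrization\<close>
  apply to it.
\<close>

lemma symmetrization2_commute:
  "symmetrization2 a b c d f t s =
     symmetrization c d (\<lambda>v. symmetrization a b (\<lambda>u. f (u, v)) t) s"
  by (simp add: symmetrization2_def symmetrization_def add_divide_distrib)

lemma symmetrization2_eq_average:
  "symmetrization2 a b c d f t s = 1/4 *
     (f (t * a + (1 - t) * ((a + b) / 2), s * c + (1 - s) * ((c + d) / 2))
    + f (t * b + (1 - t) * ((a + b) / 2), s * c + (1 - s) * ((c + d) / 2))
    + f (t * a + (1 - t) * ((a + b) / 2), s * d + (1 - s) * ((c + d) / 2))
    + f (t * b + (1 - t) * ((a + b) / 2), s * d + (1 - s) * ((c + d) / 2)))"
  by (simp add: symmetrization2_def symmetrization_def add_divide_distrib)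

lemma convex_on_symmetrized_section:
  assumes "c \<le> d" "convex_on_coords {a..b} {c..d} f" "s \<in> {0..1}"
  shows "convex_on {a..b} (\<lambda>u. symmetrization c d (\<lambda>v. f (u, v)) s)"
  unfolding symmetrization_def
  using assms segment_to_midpoint_mem[OF assms(1,3)]
  by (intro convex_on_average) (auto simp: convex_on_coords_def)

lemma convex_on_coords_swap:
  "convex_on_coords A B f \<Longrightarrow> convex_on_coords B A (\<lambda>(x, y). f (y, x))"
  by (auto simp: convex_on_coords_def)

lemma convex_on_coords_symmetrization2:
  assumes ab: "a \<le> b" and cd: "c \<le> d" and f: "convex_on_coords {a..b} {c..d} f"
  shows "convex_on_coords {0..1} {0..1} (\<lambda>(t, s). symmetrization2 a b c d f t s)"
proof -
  have "convex_on {0..1} (\<lambda>t. symmetrization2 a b c d f t s)" if "s \<in> {0..1}" for s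
    unfolding symmetrization2_def
    by (rule convex_on_symmetrization[OF ab convex_on_symmetrized_section[OF cd f that]])
  moreover have "convex_on {0..1} (\<lambda>s. symmetrization2 a b c d f t s)" if "t \<in> {0..1}" for t
    unfolding symmetrization2_commute
    using convex_on_symmetrized_section[OF ab convex_on_coords_swap[OF f] that]
    by (intro convex_on_symmetrization[OF cd]) simp
  ultimately show ?thesis
    by (simp add: convex_on_coords_def)
qed

lemma symmetrization2_bounds:
  assumes ab: "a \<le> b" and cd: "c \<le> d" and f: "convex_on_coords {a..b} {c..d} f"
    and t: "t \<in> {0..1}" and s: "s \<in> {0..1}"
  shows "f ((a + b) / 2, (c + d) / 2) \<le> symmetrization2 a b c d f t s"
    and "symmetrization2 a b c d f t s \<le> (f (a, c) + f (a, d) + f (b, c) + f (b, d)) / 4"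
proof -
  have sections: "convex_on {c..d} (\<lambda>v. f (x, v))" if "x \<in> {a..b}" for x
    using f that by (simp add: convex_on_coords_def)
  note outer = convex_on_symmetrized_section[OF cd f s]
  have "f ((a + b) / 2, (c + d) / 2) \<le> symmetrization c d (\<lambda>v. f ((a + b) / 2, v)) s"
    using ab by (intro symmetrization_ge_midpoint[OF cd _ s] sections) auto
  also have "\<dots> \<le> symmetrization2 a b c d f t s"
    unfolding symmetrization2_def by (rule symmetrization_ge_midpoint[OF ab outer t])
  finally show "f ((a + b) / 2, (c + d) / 2) \<le> symmetrization2 a b c d f t s" .
  have "symmetrization2 a b c d f t s
      \<le> (symmetrization c d (\<lambda>v. f (a, v)) s + symmetrization c d (\<lambda>v. f (b, v)) s) / 2"
    unfolding symmetrization2_def by (rule symmetrization_le_endpoints[OF ab outer t])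
  also have "\<dots> \<le> ((f (a, c) + f (a, d)) / 2 + (f (b, c) + f (b, d)) / 2) / 2"
    using ab by (intro divide_right_mono add_mono symmetrization_le_endpoints[OF cd _ s] sections) auto
  finally show "symmetrization2 a b c d f t s \<le> (f (a, c) + f (a, d) + f (b, c) + f (b, d)) / 4"
    by (simp add: field_simps)
qed

lemma lipschitzian_on_real_prod_iff:
  fixes g :: "real \<times> real \<Rightarrow> real"
  shows "lipschitzian_on (L1, L2) V g \<longleftrightarrow> 0 \<le> L1 \<and> 0 \<le> L2 \<and>
    (\<forall>(x, y)\<in>V. \<forall>(x', y')\<in>V. \<bar>g (x, y) - g (x', y')\<bar> \<le> L1 * \<bar>x - x'\<bar> + L2 * \<bar>y - y'\<bar>)"
proof -
  have basis: "Basis = {(1, 0), (0, 1) :: real \<times> real}"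
    by (auto simp: Basis_prod_def)
  show ?thesis
    unfolding lipschitzian_on_def basis by (simp add: split_beta inner_prod_def)
qed

text \<open>
  In each of the four terms the arguments of f move with speed half the side length in t and in s,
  so each term has the scaled constants, and so has their average.
\<close>

lemma lipschitzian_on_symmetrization2:
  assumes ab: "a \<le> b" and cd: "c \<le> d" and f: "lipschitzian_on (L1, L2) ({a..b} \<times> {c..d}) f"
  shows "lipschitzian_on (L1 * ((b - a) / 2), L2 * ((d - c) / 2)) ({0..1} \<times> {0..1})
    (\<lambda>(t, s). symmetrization2 a b c d f t s)"
proof -
  define X where "X e t = t * e + (1 - t) * ((a + b) / 2)" for e t
  define Y where "Y e t = t * e + (1 - t) * ((c + d) / 2)" for e t
  have L: "0 \<le> L1" "0 \<le> L2"
    and lip: "\<And>x y x' y'. x \<in> {a..b} \<Longrightarrow> x' \<in> {a..b} \<Longrightarrow> y \<in> {c..d} \<Longrightarrow> y' \<in> {c..d} \<Longrightarrow>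
      \<bar>f (x, y) - f (x', y')\<bar> \<le> L1 * \<bar>x - x'\<bar> + L2 * \<bar>y - y'\<bar>"
    using f unfolding lipschitzian_on_real_prod_iff by blast+
  have XY: "X a t \<in> {a..b}" "X b t \<in> {a..b}" "Y c t \<in> {c..d}" "Y d t \<in> {c..d}"
    if "t \<in> {0..1}" for t
    using segment_to_midpoint_mem[OF ab that] segment_to_midpoint_mem[OF cd that]
    by (simp_all only: X_def Y_def)
  have speed: "\<bar>X a t - X a t'\<bar> = (b - a) / 2 * \<bar>t - t'\<bar>" "\<bar>X b t - X b t'\<bar> = (b - a) / 2 * \<bar>t - t'\<bar>"
    "\<bar>Y c t - Y c t'\<bar> = (d - c) / 2 * \<bar>t - t'\<bar>" "\<bar>Y d t - Y d t'\<bar> = (d - c) / 2 * \<bar>t - t'\<bar>" for t t'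
  proof -
    have "X a t - X a t' = - ((b - a) / 2 * (t - t'))" "X b t - X b t' = (b - a) / 2 * (t - t')"
      "Y c t - Y c t' = - ((d - c) / 2 * (t - t'))" "Y d t - Y d t' = (d - c) / 2 * (t - t')"
      by (simp_all add: X_def Y_def field_simps)
    then show "\<bar>X a t - X a t'\<bar> = (b - a) / 2 * \<bar>t - t'\<bar>" "\<bar>X b t - X b t'\<bar> = (b - a) / 2 * \<bar>t - t'\<bar>"
      "\<bar>Y c t - Y c t'\<bar> = (d - c) / 2 * \<bar>t - t'\<bar>" "\<bar>Y d t - Y d t'\<bar> = (d - c) / 2 * \<bar>t - t'\<bar>"
      using ab cd by (simp_all only: abs_minus_cancel abs_mult) simp_all
  qed
  have S: "symmetrization2 a b c d f t s
      = 1/4 * (f (X a t, Y c s) + f (X b t, Y c s) + f (X a t, Y d s) + f (X b t, Y d s))" for t s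
    by (simp only: symmetrization2_eq_average X_def Y_def)
  have "\<bar>symmetrization2 a b c d f t s - symmetrization2 a b c d f t' s'\<bar>
      \<le> L1 * ((b - a) / 2) * \<bar>t - t'\<bar> + L2 * ((d - c) / 2) * \<bar>s - s'\<bar>"
    if "t \<in> {0..1}" "s \<in> {0..1}" "t' \<in> {0..1}" "s' \<in> {0..1}" for t s t' s'
  proof -
    define K where "K = L1 * ((b - a) / 2 * \<bar>t - t'\<bar>) + L2 * ((d - c) / 2 * \<bar>s - s'\<bar>)"
    have "\<bar>f (X a t, Y c s) - f (X a t', Y c s')\<bar> \<le> K" "\<bar>f (X a t, Y d s) - f (X a t', Y d s')\<bar> \<le> K"
      "\<bar>f (X b t, Y c s) - f (X b t', Y c s')\<bar> \<le> K" "\<bar>f (X b t, Y d s) - f (X b t', Y d s')\<bar> \<le> K"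
      using lip[OF XY(1)[OF that(1)] XY(1)[OF that(3)] XY(3)[OF that(2)] XY(3)[OF that(4)]]
        lip[OF XY(1)[OF that(1)] XY(1)[OF that(3)] XY(4)[OF that(2)] XY(4)[OF that(4)]]
        lip[OF XY(2)[OF that(1)] XY(2)[OF that(3)] XY(3)[OF that(2)] XY(3)[OF that(4)]]
        lip[OF XY(2)[OF that(1)] XY(2)[OF that(3)] XY(4)[OF that(2)] XY(4)[OF that(4)]]
      unfolding speed K_def .
    then have "\<bar>symmetrization2 a b c d f t s - symmetrization2 a b c d f t' s'\<bar> \<le> K"
      unfolding S by (simp add: abs_le_iff field_simps)
    then show ?thesis
      by (simp add: K_def mult.assoc)
  qed
  then show ?thesis
    using L ab cd unfolding lipschitzian_on_real_prod_iff by auto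
qed

lemma cInf_cSup_attained:
  fixes g :: "'a \<Rightarrow> 'b::conditionally_complete_lattice"
  assumes "x \<in> S" "y \<in> S" "\<And>z. z \<in> S \<Longrightarrow> g x \<le> g z" "\<And>z. z \<in> S \<Longrightarrow> g z \<le> g y"
  shows "bdd_below (g ` S)" "Inf (g ` S) = g x" "bdd_above (g ` S)" "Sup (g ` S) = g y"
  using assms by (auto intro!: bdd_belowI2 bdd_aboveI2 cInf_eq_minimum cSup_eq_maximum)

section \<open>Convexity, extrema, Lipschitz continuity and the integral bound\<close>

theorem theorem6:
  fixes a b c d :: real and f G :: "real \<times> real \<Rightarrow> real"
  assumes ab: "a < b" and cd: "c < d"
    and f: "convex_on_coords {a..b} {c..d} f"
    and G: "\<And>t s. t \<in> {0..1} \<Longrightarrow> s \<in> {0..1} \<Longrightarrow>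
      G (t, s) = 1/4 *
        (f (t * a + (1 - t) * ((a + b) / 2), s * c + (1 - s) * ((c + d) / 2))
       + f (t * b + (1 - t) * ((a + b) / 2), s * c + (1 - s) * ((c + d) / 2))
       + f (t * a + (1 - t) * ((a + b) / 2), s * d + (1 - s) * ((c + d) / 2))
       + f (t * b + (1 - t) * ((a + b) / 2), s * d + (1 - s) * ((c + d) / 2)))"
  shows "(convex_on_coords {0..1} {0..1} G)
    \<and> (bdd_below (G ` ({0..1} \<times> {0..1}))
       \<and> Inf (G ` ({0..1} \<times> {0..1})) = f ((a + b) / 2, (c + d) / 2)
       \<and> f ((a + b) / 2, (c + d) / 2) = G (0, 0))
    \<and> (bdd_above (G ` ({0..1} \<times> {0..1}))
       \<and> Sup (G ` ({0..1} \<times> {0..1})) = (f (a, c) + f (a, d) + f (b, c) + f (b, d)) / 4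
       \<and> (f (a, c) + f (a, d) + f (b, c) + f (b, d)) / 4 = G (1, 1))
    \<and> ((\<exists>L. lipschitzian_on L ({a..b} \<times> {c..d}) f)
       \<longrightarrow> (\<exists>L'. lipschitzian_on L' ({0..1} \<times> {0..1}) G))
    \<and> ((\<forall>x\<in>{a..b}. (\<lambda>y. f (x, y)) integrable_on {c..d})
       \<and> (\<lambda>x. integral {c..d} (\<lambda>y. f (x, y))) integrable_on {a..b}
       \<and> 1 / ((b - a) * (d - c)) * integral {a..b} (\<lambda>x. integral {c..d} (\<lambda>y. f (x, y)))
         \<le> 1/4 * ((f (a, c) + f (b, c) + f (a, d) + f (b, d)) / 4
                + (f ((a + b) / 2, c) + f ((a + b) / 2, d)) / 2
                + (f (a, (c + d) / 2) + f (b, (c + d) / 2)) / 2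
                + f ((a + b) / 2, (c + d) / 2)))"
proof -
  let ?Q = "{0..1} \<times> {0..1} :: (real \<times> real) set"
  have le: "a \<le> b" "c \<le> d"
    using ab cd by auto
  have GS: "G (t, s) = symmetrization2 a b c d f t s" if "t \<in> {0..1}" "s \<in> {0..1}" for t s
    unfolding symmetrization2_eq_average by (rule G[OF that])
  have convex: "convex_on_coords {0..1} {0..1} G"
    using convex_on_coords_symmetrization2[OF le f] GS
    by (auto simp: convex_on_coords_def intro: convex_on_cong_fun)
  have G0: "G (0, 0) = f ((a + b) / 2, (c + d) / 2)"
    and G1: "G (1, 1) = (f (a, c) + f (a, d) + f (b, c) + f (b, d)) / 4"
    by (simp_all add: GS symmetrization2_def symmetrization_0 symmetrization_1 add_divide_distrib)
  have "G (0, 0) \<le> G z" "G z \<le> G (1, 1)" if "z \<in> ?Q" for z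
    using symmetrization2_bounds[OF le f] that unfolding G0 G1 by (auto simp: GS)
  note extrema = cInf_cSup_attained[of "(0, 0)" ?Q "(1, 1)" G, OF _ _ this, simplified]
  have lipschitz: "\<exists>L'. lipschitzian_on L' ?Q G"
    if "lipschitzian_on L ({a..b} \<times> {c..d}) f" for L
  proof -
    obtain L1 L2 where "L = (L1, L2)"
      by (cases L)
    with that have "lipschitzian_on (L1 * ((b - a) / 2), L2 * ((d - c) / 2)) ?Q
        (\<lambda>(t, s). symmetrization2 a b c d f t s)"
      using lipschitzian_on_symmetrization2[OF le] by simp
    then have "lipschitzian_on (L1 * ((b - a) / 2), L2 * ((d - c) / 2)) ?Q G"
      by (auto simp: lipschitzian_on_real_prod_iff GS)
    then show ?thesis ..
  qed
  have inner: "(\<lambda>y. f (x, y)) integrable_on {c..d}" if "x \<in> {a..b}" for x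
    using f that by (intro convex_on_imp_integrable) (auto simp: convex_on_coords_def)
  have outer: "(\<lambda>x. integral {c..d} (\<lambda>y. f (x, y))) integrable_on {a..b}"
    by (rule convex_on_imp_integrable[OF convex_on_integral_section[OF f]])
  have "1 / ((b - a) * (d - c)) * I \<le> K" if "I \<le> (b - a) * (d - c) * K" for I K
    using that ab cd by (simp add: divide_le_eq mult.commute)
  note bullen = this[OF bullen_inequality_coords[OF le f]]
  show ?thesis
    using convex extrema G0 G1 lipschitz inner outer bullen by auto
qed

end
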